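(* For every $n\in\mathbb{N}$, the pair $(\ell_2^n,\ell_2^n)$ of real Hilbert spaces has the non-trivial norm preserving uniform BPB approximation property: for every $T\in S_{\mathbb{L}(\ell_2^n,\ell_2^n)}$ that is not an isometry and every $\epsilon>0$, $T$ admits a non-trivial uniform $\epsilon$-BPB approximation $A_\epsilon$ with $M_T=M_{A_\epsilon}$.
   Context: $\mathbb{L}(\mathbb{X},\mathbb{Y})$ is the space of bounded linear operators with the operator norm; $S_Z$ is the unit sphere of a normed space $Z$. For $A\in\mathbb{L}(\mathbb{X},\mathbb{Y})$, $M_A=\{x\in S_{\mathbb{X}}:\|Ax\|=\|A\|\}$. For $T\in S_{\mathbb{L}(\mathbb{X},\mathbb{Y})}$ and $\epsilon>0$, an operator $A\in S_{\mathbb{L}(\mathbb{X},\mathbb{Y})}$ is a uniform $\epsilon$-BPB approximation of $T$ if $\|T-A\|<\epsilon$ and there exists $\delta(\epsilon)>0$ such that for each $x_0\in S_{\mathbb{X}}$ with $\|Tx_0\|>1-\delta(\epsilon)$ there exists $u_0\in M_A$ with $\|u_0-x_0\|<\epsilon$. It is non-trivial if in addition $A\neq T$. *)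

theory Defs
  imports "HOL-Analysis.Analysis"
begin

definition norm_attainment_set ::
    "('a::real_normed_vector \<Rightarrow>\<^sub>L 'b::real_normed_vector) \<Rightarrow> 'a set"
  where "norm_attainment_set A = {x \<in> sphere 0 1. norm (blinfun_apply A x) = norm A}"

definition blinfun_isometry ::
    "('a::real_normed_vector \<Rightarrow>\<^sub>L 'b::real_normed_vector) \<Rightarrow> bool"
  where "blinfun_isometry T \<longleftrightarrow>
    (\<forall>x y. dist (blinfun_apply T x) (blinfun_apply T y) = dist x y)"

text \<open>The number \<open>\<delta>\<close> may depend on \<open>\<epsilon>\<close>, \<open>T\<close> and \<open>A\<close>,
  but not on the point \<open>x\<^sub>0\<close>. The notion is only meant for \<open>T\<close> of norm one
  and \<open>\<epsilon> > 0\<close>.\<close>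

definition uniform_BPB_approximation ::
    "real \<Rightarrow> ('a::real_normed_vector \<Rightarrow>\<^sub>L 'b::real_normed_vector) \<Rightarrow> ('a \<Rightarrow>\<^sub>L 'b) \<Rightarrow> bool"
  where "uniform_BPB_approximation \<epsilon> T A \<longleftrightarrow>
    A \<in> sphere 0 1 \<and> norm (T - A) < \<epsilon> \<and>
    (\<exists>\<delta>>0. \<forall>x\<^sub>0 \<in> sphere 0 1. norm (blinfun_apply T x\<^sub>0) > 1 - \<delta> \<longrightarrow>
      (\<exists>u\<^sub>0 \<in> norm_attainment_set A. norm (u\<^sub>0 - x\<^sub>0) < \<epsilon>))"

definition nontrivial_uniform_BPB_approximation ::
    "real \<Rightarrow> ('a::real_normed_vector \<Rightarrow>\<^sub>L 'b::real_normed_vector) \<Rightarrow> ('a \<Rightarrow>\<^sub>L 'b) \<Rightarrow> bool"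
  where "nontrivial_uniform_BPB_approximation \<epsilon> T A \<longleftrightarrow>
    uniform_BPB_approximation \<epsilon> T A \<and> A \<noteq> T"

end

theory Submission
  imports Defs
begin

text \<open>Perturb \<open>T\<close> inside the contractions without changing the set of vectors whose norm it
  preserves. As \<open>T\<^sup>* T x = x\<close> whenever \<open>\<parallel>T x\<parallel> = \<parallel>x\<parallel>\<close>, the operator
  \<open>(1 - t) T + t T T\<^sup>* T\<close> with small \<open>t > 0\<close> does this, and it differs from \<open>T\<close> unless \<open>T\<close> is a
  partial isometry. A partial isometry of \<open>\<real>\<^sup>n\<close> that is not an isometry has a unit vector \<open>u\<close> in its
  kernel and a unit vector \<open>w\<close> orthogonal to its range, and \<open>x \<mapsto> T x + t (u \<bullet> x) w\<close> does it.
  Compactness of the unit sphere then provides \<open>\<delta>\<close> for every contraction close to \<open>T\<close> that attains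
  its norm on the same set.\<close>

text \<open>Compactness of the unit sphere gives a maximizer. It is needed to see that a contraction
  preserving the norms of the same vectors as \<open>T\<close> still has norm one.\<close>

lemma norm_attainment_set_nonempty:
  fixes T :: "'a::euclidean_space \<Rightarrow>\<^sub>L 'b::real_normed_vector"
  shows "norm_attainment_set T \<noteq> {}"
proof -
  have "compact (sphere (0::'a) 1)" "sphere (0::'a) 1 \<noteq> {}"
    by auto
  moreover have "continuous_on (sphere 0 1) (\<lambda>x. norm (blinfun_apply T x))"
    by (intro continuous_intros)
  ultimately obtain x where x: "x \<in> sphere 0 1"
      "\<And>y. y \<in> sphere 0 1 \<Longrightarrow> norm (blinfun_apply T y) \<le> norm (blinfun_apply T x)"
    using continuous_attains_sup by metis
  have "norm T \<le> norm (blinfun_apply T x)"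
  proof (rule norm_blinfun_bound)
    fix z :: 'a
    show "norm (blinfun_apply T z) \<le> norm (blinfun_apply T x) * norm z"
    proof (cases "z = 0")
      case False
      then have "norm (blinfun_apply T (z /\<^sub>R norm z)) \<le> norm (blinfun_apply T x)"
        by (intro x) auto
      with False show ?thesis
        by (simp add: blinfun.scaleR_right field_simps)
    qed simp
  qed simp
  with x norm_blinfun[of T x] show ?thesis
    by (force simp: norm_attainment_set_def)
qed

text \<open>Outside the \<epsilon>-balls around the attaining vectors lies a compact part
  \<open>K\<close> of the sphere containing none of them. The norm of \<open>T x\<close> therefore
  has a maximum on \<open>K\<close> strictly below \<open>norm T\<close>, and the gap serves as
  \<delta>.\<close>

lemma near_norm_attainment_set:
  fixes T :: "'a::euclidean_space \<Rightarrow>\<^sub>L 'b::real_normed_vector"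
  assumes "\<epsilon> > 0"
  obtains \<delta> where "\<delta> > 0"
    "\<And>x. x \<in> sphere 0 1 \<Longrightarrow> norm (blinfun_apply T x) > norm T - \<delta> \<Longrightarrow>
      \<exists>u \<in> norm_attainment_set T. norm (u - x) < \<epsilon>"
proof -
  define K where "K = sphere 0 1 - (\<Union>u\<in>norm_attainment_set T. ball u \<epsilon>)"
  have K: "compact K"
    unfolding K_def by (intro compact_diff compact_sphere open_UN ballI open_ball)
  have *: "\<exists>u \<in> norm_attainment_set T. norm (u - x) < \<epsilon>" if "x \<in> sphere 0 1" "x \<notin> K" for x
    using that by (auto simp: K_def dist_norm)
  show thesis
  proof (cases "K = {}")
    case True
    with * show thesis
      by (intro that[of 1]) auto
  next
    case False
    moreover have "continuous_on K (\<lambda>x. norm (blinfun_apply T x))"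
      by (intro continuous_intros)
    ultimately obtain x where x: "x \<in> K"
        "\<And>y. y \<in> K \<Longrightarrow> norm (blinfun_apply T y) \<le> norm (blinfun_apply T x)"
      using continuous_attains_sup[OF K] by metis
    have "norm (blinfun_apply T x) < norm T"
      using x(1) \<open>\<epsilon> > 0\<close> norm_blinfun[of T x] by (force simp: K_def norm_attainment_set_def)
    with * x(2) show thesis
      by (intro that[of "norm T - norm (blinfun_apply T x)"]) force+
  qed
qed

text \<open>Once both operators have norm one, attaining the norm at a unit vector means preserving
  its length, so \<open>preserved\<close> makes the two attainment sets equal. The \<delta> found
  for \<open>T\<close> and its own attainment set then works for \<open>A\<close>.\<close>

lemma nontrivial_uniform_BPB_approximation_contraction:
  fixes T A :: "'a::euclidean_space \<Rightarrow>\<^sub>L 'b::real_normed_vector"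
  assumes "norm T = 1" "\<epsilon> > 0" "norm (T - A) < \<epsilon>" "A \<noteq> T"
    and contraction: "\<And>x. norm (blinfun_apply A x) \<le> norm x"
    and preserved: "\<And>x. norm (blinfun_apply A x) = norm x \<longleftrightarrow> norm (blinfun_apply T x) = norm x"
  shows "nontrivial_uniform_BPB_approximation \<epsilon> T A \<and>
    norm_attainment_set T = norm_attainment_set A"
proof -
  obtain x where x: "x \<in> norm_attainment_set T"
    using norm_attainment_set_nonempty[of T] by blast
  have "norm A \<le> 1"
    using contraction by (intro norm_blinfun_bound) auto
  moreover have "norm A \<ge> 1"
    using x assms norm_blinfun[of A x] preserved[of x] by (auto simp: norm_attainment_set_def)
  ultimately have A: "norm A = 1"
    by simp
  with assms have eq: "norm_attainment_set T = norm_attainment_set A"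
    by (auto simp: norm_attainment_set_def) (metis preserved)+
  with A assms near_norm_attainment_set[OF \<open>\<epsilon> > 0\<close>, of T] show ?thesis
    unfolding nontrivial_uniform_BPB_approximation_def uniform_BPB_approximation_def
    by (metis mem_sphere_0)
qed

lemma norm_adjoint_le:
  fixes f :: "'a::euclidean_space \<Rightarrow> 'b::euclidean_space"
  assumes "linear f" and contraction: "\<And>x. norm (f x) \<le> norm x"
  shows "norm (adjoint f y) \<le> norm y"
proof -
  have "norm (adjoint f y) * norm (adjoint f y) = f (adjoint f y) \<bullet> y"
    using adjoint_works[OF \<open>linear f\<close>, of "adjoint f y" y]
    by (simp add: dot_square_norm power2_eq_square)
  also have "\<dots> \<le> norm (f (adjoint f y)) * norm y"
    by (rule norm_cauchy_schwarz)
  also have "\<dots> \<le> norm (adjoint f y) * norm y"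
    by (intro mult_right_mono contraction) simp
  finally show ?thesis
    by (cases "norm (adjoint f y) = 0") (auto simp: mult_le_cancel_left)
qed

text \<open>Expanding the square of \<open>norm (adjoint f (f x) - x)\<close> gives at most
  \<open>(norm x)\<^sup>2 - 2 * (norm x)\<^sup>2 + (norm x)\<^sup>2\<close>, which is zero.\<close>

lemma adjoint_norm_preserved:
  fixes f :: "'a::euclidean_space \<Rightarrow> 'b::euclidean_space"
  assumes "linear f" and "\<And>x. norm (f x) \<le> norm x" and "norm (f x) = norm x"
  shows "adjoint f (f x) = x"
proof -
  have "norm (adjoint f (f x)) \<le> norm x"
    using norm_adjoint_le[OF assms(1,2), of "f x"] assms(3) by simp
  then have "(norm (adjoint f (f x)))\<^sup>2 \<le> (norm x)\<^sup>2"
    by simp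
  moreover have "adjoint f (f x) \<bullet> x = (norm x)\<^sup>2"
    using adjoint_works[OF \<open>linear f\<close>, of x "f x"] assms(3)
    by (simp add: inner_commute dot_square_norm)
  ultimately have "(norm (adjoint f (f x) - x))\<^sup>2 \<le> 0"
    unfolding power2_norm_eq_inner by (simp add: inner_diff inner_commute)
  then show ?thesis
    by simp
qed

theorem theorem5p4:
  fixes T :: "(real ^ 'n) \<Rightarrow>\<^sub>L (real ^ 'n)" and \<epsilon> :: real
  assumes "T \<in> sphere 0 1" and "\<not> blinfun_isometry T" and "\<epsilon> > 0"
  shows "\<exists>A :: (real ^ 'n) \<Rightarrow>\<^sub>L (real ^ 'n).
    nontrivial_uniform_BPB_approximation \<epsilon> T A \<and>
    norm_attainment_set T = norm_attainment_set A"
proof -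
  let ?T = "blinfun_apply T" and ?S = "adjoint (blinfun_apply T)"
  have norm_T: "norm T = 1"
    using assms(1) by simp
  then have contr: "norm (?T x) \<le> norm x" for x
    using norm_blinfun[of T x] by simp
  have lin: "linear ?T"
    by (intro bounded_linear.linear blinfun.bounded_linear_right)
  note S_le = norm_adjoint_le[OF lin contr] and S_eq = adjoint_norm_preserved[OF lin contr]
  \<comment> \<open>The distance from \<open>T\<close> to \<open>A\<close> will be at most
    \<open>2 * t\<close> in the first case and at most \<open>t\<close> in the second; the cap 1/2
    keeps \<open>1 - t\<close> and \<open>1 - t\<^sup>2\<close> positive.\<close>
  define t where "t = min (1/2) (\<epsilon>/4)"
  have t: "0 < t" "t < 1" "2 * t < \<epsilon>"
    using \<open>\<epsilon> > 0\<close> by (auto simp: t_def)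
  show ?thesis
  proof (cases "\<forall>x. ?T (?S (?T x)) = ?T x")
    case False
    have linS: "linear (\<lambda>x. ?T (?S (?T x)))"
      using linear_compose[OF linear_compose[OF lin adjoint_linear[OF lin]] lin]
      by (simp add: o_def)
    define A where "A = (1 - t) *\<^sub>R T + t *\<^sub>R Blinfun (\<lambda>x. ?T (?S (?T x)))"
    have A: "blinfun_apply A x = (1 - t) *\<^sub>R ?T x + t *\<^sub>R ?T (?S (?T x))" for x
      unfolding A_def
      by (simp add: blinfun.add_left blinfun.scaleR_left bounded_linear_Blinfun_apply
          linear_conv_bounded_linear[THEN iffD1, OF linS])
    have TST: "norm (?T (?S (?T x))) \<le> norm (?T x)" for x
      using contr S_le order_trans by blast
    \<comment> \<open>Comparing with \<open>norm (?T x)\<close> instead of \<open>norm x\<close>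
      pays off twice: it gives contraction, and it shows that \<open>T\<close> preserves every norm
      that \<open>A\<close> preserves.\<close>
    have A_le: "norm (blinfun_apply A x) \<le> norm (?T x)" for x
    proof -
      have "norm (blinfun_apply A x) \<le> (1 - t) * norm (?T x) + t * norm (?T (?S (?T x)))"
        unfolding A using t by (intro norm_triangle_le) simp
      also have "\<dots> \<le> (1 - t) * norm (?T x) + t * norm (?T x)"
        using t TST by (intro add_left_mono mult_left_mono) auto
      finally show ?thesis
        by (simp add: algebra_simps)
    qed
    have "norm (T - A) \<le> 2 * t"
    proof (rule norm_blinfun_bound)
      fix x
      have "blinfun_apply (T - A) x = t *\<^sub>R (?T x - ?T (?S (?T x)))"
        by (simp add: blinfun.diff_left A algebra_simps)
      moreover have "norm (?T x - ?T (?S (?T x))) \<le> norm x + norm x"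
        by (rule order_trans[OF norm_triangle_ineq4 add_mono])
          (use contr TST order_trans in blast)+
      ultimately show "norm (blinfun_apply (T - A) x) \<le> 2 * t * norm x"
        using t by simp
    qed (use t in simp)
    then have "norm (T - A) < \<epsilon>"
      using t by simp
    moreover have "A \<noteq> T"
    proof
      assume "A = T"
      with A have "?T x = ?T (?S (?T x)) \<or> t = 0" for x
        by (simp add: algebra_simps)
      with False t show False
        by fastforce
    qed
    moreover have "norm (blinfun_apply A x) \<le> norm x" for x
      using A_le contr order_trans by blast
    moreover have "norm (blinfun_apply A x) = norm x \<longleftrightarrow> norm (?T x) = norm x" for x
    proof
      assume "norm (blinfun_apply A x) = norm x"
      then show "norm (?T x) = norm x"
        using A_le[of x] contr[of x] by simp
    next
      assume "norm (?T x) = norm x"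
      moreover from S_eq[OF this] have "blinfun_apply A x = ?T x"
        by (simp add: A algebra_simps)
      ultimately show "norm (blinfun_apply A x) = norm x"
        by simp
    qed
    ultimately show ?thesis
      using nontrivial_uniform_BPB_approximation_contraction[OF norm_T \<open>\<epsilon> > 0\<close>] by blast
  next
    case partial_isometry: True
    \<comment> \<open>If \<open>?S\<close> were a left inverse of \<open>?T\<close>, then
      \<open>?T x \<bullet> ?T x = x \<bullet> x\<close> would hold throughout, making
      \<open>T\<close> an isometry.\<close>
    have "\<exists>y. ?S (?T y) \<noteq> y"
    proof (rule ccontr)
      assume "\<not> ?thesis"
      then have "norm (?T x) = norm x" for x
        using adjoint_works[OF lin, of x "?T x"] by (simp add: norm_eq)
      then have "blinfun_isometry T"
        by (simp add: blinfun_isometry_def dist_norm flip: blinfun.diff_right)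
      with assms(2) show False ..
    qed
    then obtain y where y: "?S (?T y) - y \<noteq> 0"
      by auto
    \<comment> \<open>The defect of \<open>?S\<close> as a left inverse lies in the kernel, by the
      case assumption. Normalized, it becomes \<open>u\<close>.\<close>
    have y0: "?T (?S (?T y) - y) = 0"
      using partial_isometry by (simp add: blinfun.diff_right)
    define u where "u = sgn (?S (?T y) - y)"
    have u: "norm u = 1" "?T u = 0"
      using y y0 by (auto simp: u_def norm_sgn sgn_div_norm blinfun.scaleR_right)
    \<comment> \<open>Domain and codomain have equal dimension, so a nontrivial kernel leaves room
      for a vector orthogonal to the range.\<close>
    have "\<not> surj ?T"
      using linear_surjective_imp_injective[OF lin] y y0 by (metis blinfun.zero_right injD)
    then have "span (range ?T) \<noteq> UNIV"
      using lin by (metis linear_span_image span_UNIV)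
    then obtain v where v: "v \<noteq> 0" "\<And>x. v \<bullet> ?T x = 0"
      using span_not_UNIV_orthogonal[of "range ?T"] by (metis rangeI span_base)
    define w where "w = sgn v"
    have w: "norm w = 1" "\<And>x. ?T x \<bullet> w = 0"
      using v by (auto simp: w_def norm_sgn sgn_div_norm inner_commute)
    define A where "A = T + t *\<^sub>R (blinfun_scaleR_left w o\<^sub>L blinfun_inner_right u)"
    have A: "blinfun_apply A x = ?T x + (t * (u \<bullet> x)) *\<^sub>R w" for x
      by (simp add: A_def blinfun.add_left blinfun.scaleR_left)
    \<comment> \<open>\<open>T\<close> ignores the component of \<open>x\<close> along
      \<open>u\<close>, so contractivity applied to the remaining component leaves
      \<open>(u \<bullet> x)\<^sup>2\<close> to spare.\<close>
    have T_le: "(norm (?T x))\<^sup>2 + (u \<bullet> x)\<^sup>2 \<le> (norm x)\<^sup>2" for x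
    proof -
      have "?T x = ?T (x - (u \<bullet> x) *\<^sub>R u)"
        using u by (simp add: blinfun.diff_right blinfun.scaleR_right)
      then have "(norm (?T x))\<^sup>2 \<le> (norm (x - (u \<bullet> x) *\<^sub>R u))\<^sup>2"
        by (metis contr norm_ge_zero power_mono)
      also have "\<dots> = (norm x)\<^sup>2 - (u \<bullet> x)\<^sup>2"
        using u(1) unfolding power2_norm_eq_inner norm_eq_1
        by (simp add: inner_diff inner_commute power2_eq_square)
      finally show ?thesis
        by simp
    qed
    \<comment> \<open>The added term is orthogonal to the range of \<open>T\<close>, so it costs
      only \<open>t\<^sup>2\<close> times the spare amount.\<close>
    have A_norm: "(norm (blinfun_apply A x))\<^sup>2 = (norm (?T x))\<^sup>2 + t\<^sup>2 * (u \<bullet> x)\<^sup>2" for x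
      using w norm_add_Pythagorean[of "?T x" "(t * (u \<bullet> x)) *\<^sub>R w"]
      by (simp add: A orthogonal_def power_mult_distrib)
    have t2: "t\<^sup>2 < 1"
      using t by (simp add: power_less_one_iff)
    have A_le: "(norm (blinfun_apply A x))\<^sup>2 + (1 - t\<^sup>2) * (u \<bullet> x)\<^sup>2 \<le> (norm x)\<^sup>2" for x
      using T_le[of x] by (simp add: A_norm algebra_simps)
    have "norm (T - A) \<le> t"
    proof (rule norm_blinfun_bound)
      fix x
      have "\<bar>u \<bullet> x\<bar> \<le> norm x"
        using Cauchy_Schwarz_ineq2[of u x] u by simp
      then show "norm (blinfun_apply (T - A) x) \<le> t * norm x"
        using t w by (simp add: blinfun.diff_left A abs_mult)
    qed (use t in simp)
    then have "norm (T - A) < \<epsilon>"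
      using t by simp
    moreover have "A \<noteq> T"
    proof
      assume "A = T"
      with A[of u] have "(t * (u \<bullet> u)) *\<^sub>R w = 0"
        by simp
      with t u w show False
        by auto
    qed
    moreover have "norm (blinfun_apply A x) \<le> norm x" for x
    proof (rule power2_le_imp_le)
      have "0 \<le> (1 - t\<^sup>2) * (u \<bullet> x)\<^sup>2"
        using t2 by simp
      with A_le[of x] show "(norm (blinfun_apply A x))\<^sup>2 \<le> (norm x)\<^sup>2"
        by linarith
    qed simp
    \<comment> \<open>Equality on either side leaves no slack in \<open>A_le\<close> or
      \<open>T_le\<close>, forcing \<open>u \<bullet> x = 0\<close>; at such \<open>x\<close> the
      operators agree.\<close>
    moreover have "norm (blinfun_apply A x) = norm x \<longleftrightarrow> norm (?T x) = norm x" for x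
    proof -
      have "u \<bullet> x = 0" if "norm (blinfun_apply A x) = norm x"
        using A_le[of x] t2 that by (auto simp: mult_le_0_iff)
      moreover have "u \<bullet> x = 0" if "norm (?T x) = norm x"
        using T_le[of x] that by simp
      ultimately show ?thesis
        by (auto simp: A)
    qed
    ultimately show ?thesis
      using nontrivial_uniform_BPB_approximation_contraction[OF norm_T \<open>\<epsilon> > 0\<close>] by blast
  qed
qed

end
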